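(* Let $k$ and $t$ be positive integers. Then $$ s'_t([-k,k]) = \begin{cases} t+k^2-k & \text{if } \operatorname{lcm}(2,3,\ldots,\max(2,2k-1)) \mid t,\\ \infty & \text{otherwise.} \end{cases} $$
   Context: A sequence is a finite multiset of integers; for a sequence $S$, $|S|$ is its length (counted with multiplicity), $\sigma(S)$ is the sum of its terms, and $T \mid S$ means $T$ is a subsequence (sub-multiset) of $S$. $S$ is a zero-sum sequence if $\sigma(S)=0$. $S$ is $k$-bounded if all its terms lie in $[-k,k]$. For $t\in\mathbb N$, $s'_t([-k,k])$ denotes the minimal integer $\ell$ (or $\infty$ if none exists) such that every $k$-bounded zero-sum sequence $S$ with $|S|\ge \ell$ has a subsequence $T\mid S$ with $\sigma(T)=0$ and $|T|=t$. *)

theory Defs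
  imports Main "HOL-Library.Multiset" "HOL-Library.Extended_Nat"
begin

definition bounded_seq :: "nat \<Rightarrow> int multiset \<Rightarrow> bool" where
  "bounded_seq k S \<longleftrightarrow> (\<forall>x\<in>#S. - int k \<le> x \<and> x \<le> int k)"

definition good_length :: "nat \<Rightarrow> nat \<Rightarrow> nat \<Rightarrow> bool" where
  "good_length k t l \<longleftrightarrow>
     (\<forall>S. bounded_seq k S \<and> sum_mset S = 0 \<and> size S \<ge> l \<longrightarrow>
        (\<exists>T. T \<subseteq># S \<and> sum_mset T = 0 \<and> size T = t))"

definition s_prime :: "nat \<Rightarrow> nat \<Rightarrow> enat" where
  "s_prime t k = (if \<exists>l. good_length k t l then enat (LEAST l. good_length k t l) else \<infinity>)"

end

(* A zero-sum sequence S of length t + c contains a zero-sum subsequence of length t iff it contains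
   one of length c, so for the upper bound it suffices to find a short one. Counting shows that some
   a > 0 and some -b < 0 occur at least k^2 - 2 times in S. Removing copies of the block made of
   b terms a and a terms -b, one may assume k^2 - k <= c < k^2 - k + a + b. By the pigeonhole
   principle there are fewer than a + b terms R among those other than a, -b for which the sum of
   x - a is congruent modulo a + b to that over all terms. The congruence is exactly what is needed
   to complete R by copies of a and -b to a zero-sum sequence of length c, and the bound on the size
   of R makes the two multiplicities nonnegative and small.
   If some j <= max 2 (2k - 1) does not divide t, then neither does a sum a + b of coprime
   a, b <= k, and a zero-sum sequence over {a, -b} has length divisible by a + b. *)
theory Submission
  imports Defs
begin

section \<open>Short subsequences with a prescribed residue\<close>

text \<open>List the elements of \<open>M\<close>: the first \<open>m + 1\<close> prefix sums share
  only \<open>m\<close> residues modulo \<open>m\<close>, so two agree, and the block between them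
  works.\<close>

lemma nonempty_submultiset_sum_dvd:
  fixes f :: "'a \<Rightarrow> int"
  assumes "m > 0" and "size M \<ge> m"
  obtains T where "T \<subseteq># M" "T \<noteq> {#}" "int m dvd (\<Sum>x\<in>#T. f x)"
proof -
  obtain xs where xs: "mset xs = M"
    using ex_mset by blast
  define p where "p i = sum_list (map f (take i xs)) mod int m" for i
  have "p ` {0..m} \<subseteq> {0..<int m}"
    using assms by (auto simp: p_def)
  then have "card (p ` {0..m}) \<le> card {0..<int m}"
    by (intro card_mono) auto
  then have "\<not> inj_on p {0..m}"
    by (intro pigeonhole) auto
  then obtain i j where ij: "i < j" "j \<le> m" "p i = p j"
    unfolding inj_on_def by (metis atLeastAtMost_iff linorder_neqE_nat)
  define ys where "ys = drop i (take j xs)"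
  have tk: "take j xs = take i xs @ ys"
    using ij unfolding ys_def
    by (metis append_take_drop_id min.strict_order_iff take_take)
  have "mset ys \<subseteq># M"
    using xs unfolding ys_def
    by (metis append_take_drop_id mset_append mset_subset_eq_add_left mset_subset_eq_add_right subset_mset.order_trans)
  moreover have "length xs \<ge> m"
    using assms xs by auto
  then have "mset ys \<noteq> {#}"
    using ij by (auto simp: ys_def)
  moreover have "int m dvd (\<Sum>x\<in>#mset ys. f x)"
  proof -
    have "int m dvd sum_list (map f (take j xs)) - sum_list (map f (take i xs))"
      using ij(3) unfolding p_def by (metis mod_eq_dvd_iff)
    then show ?thesis
      by (simp add: tk flip: sum_mset_sum_list)
  qed
  ultimately show ?thesis
    using that by blast
qed

text \<open>Take \<open>R\<close> of least size in the residue class of the full sum. Deleting a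
  nonempty part with sum divisible by \<open>m\<close> would stay in the class, so \<open>R\<close>
  has no such part; in particular \<open>R\<close> itself is none, and the pigeonhole lemma forces
  \<open>size R < m\<close>.\<close>

lemma short_congruent_submultiset:
  fixes f :: "'a \<Rightarrow> int"
  assumes "m > 0"
  obtains R where "R \<subseteq># M" "size R < m"
    "int m dvd (\<Sum>x\<in>#M. f x) - (\<Sum>x\<in>#R. f x)"
    "R = {#} \<or> \<not> int m dvd (\<Sum>x\<in>#R. f x)"
proof -
  define P where "P R \<longleftrightarrow> R \<subseteq># M \<and> int m dvd (\<Sum>x\<in>#M. f x) - (\<Sum>x\<in>#R. f x)" for R
  have "P M"
    by (simp add: P_def)
  then obtain R where R: "P R" and least: "\<And>R'. P R' \<Longrightarrow> size R \<le> size R'"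
    using ex_has_least_nat[of P M size] by blast
  have drop: "P (R - T)" if "T \<subseteq># R" "int m dvd (\<Sum>x\<in>#T. f x)" for T
  proof -
    have "(\<Sum>x\<in>#R - T. f x) = (\<Sum>x\<in>#R. f x) - (\<Sum>x\<in>#T. f x)"
      using that(1) by (simp add: image_mset_Diff sum_mset_diff image_mset_subseteq_mono)
    moreover have "int m dvd ((\<Sum>x\<in>#M. f x) - (\<Sum>x\<in>#R. f x)) + (\<Sum>x\<in>#T. f x)"
      using R that(2) unfolding P_def by (intro dvd_add) auto
    moreover have "R - T \<subseteq># M"
      using R unfolding P_def by (meson diff_subset_eq_self subset_mset.order_trans)
    ultimately show ?thesis
      by (simp add: P_def diff_add_eq diff_diff_eq2)
  qed
  have minimal: "T = {#}" if "T \<subseteq># R" "int m dvd (\<Sum>x\<in>#T. f x)" for T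
  proof -
    have "size R \<le> size R - size T"
      using least[OF drop[OF that]] that(1) by (simp add: size_Diff_submset)
    moreover have "size T \<le> size R"
      using that(1) by (rule size_mset_mono)
    ultimately have "size T = 0"
      by linarith
    then show ?thesis
      by simp
  qed
  have "size R < m"
  proof (rule ccontr)
    assume "\<not> size R < m"
    then obtain T where "T \<subseteq># R" "T \<noteq> {#}" "int m dvd (\<Sum>x\<in>#T. f x)"
      using nonempty_submultiset_sum_dvd[of m R f] assms by (metis not_less)
    then show False
      using minimal by blast
  qed
  then show ?thesis
    using that R minimal[of R] unfolding P_def by blast
qed

section \<open>Frequent terms of a zero-sum sequence\<close>

lemma sum_mset_image_eq_sum_count:
  fixes f :: "'a \<Rightarrow> int"
  assumes "finite A" and "set_mset M \<subseteq> A"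
  shows "(\<Sum>x\<in>#M. f x) = (\<Sum>x\<in>A. int (count M x) * f x)"
  using assms(2)
proof (induction M)
  case (add y M)
  have "(\<Sum>x\<in>A. int (count (add_mset y M) x) * f x)
      = (\<Sum>x\<in>A. int (count M x) * f x + (if x = y then f x else 0))"
    by (intro sum.cong) (auto simp: algebra_simps)
  also have "\<dots> = (\<Sum>x\<in>A. int (count M x) * f x) + f y"
    using add.prems assms(1) by (simp add: sum.distrib)
  finally show ?case
    using add by simp
qed simp

lemma frequent_positive:
  assumes "bounded_seq k S" and "sum_mset S = 0"
    and large: "size S > count S 0 + r * (\<Sum>i=1..k. i + 1)"
  obtains a where "1 \<le> a" "a \<le> k" "count S (int a) > r"
proof (rule ccontr)
  assume "\<not> thesis"
  then have few: "count S (int i) \<le> r" if "i \<in> {1..k}" for i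
    using that \<open>\<And>a. 1 \<le> a \<Longrightarrow> a \<le> k \<Longrightarrow> r < count S (int a) \<Longrightarrow> thesis\<close>
    by (meson atLeastAtMost_iff not_le_imp_less)
  \<comment> \<open>As \<open>S\<close> has sum 0, weighting each term \<open>x\<close> by \<open>1 + x\<close> still yields the size of \<open>S\<close>,
    and negative terms contribute at most 0.\<close>
  define w where "w x = (if x = 0 then 1 else if x > 0 then 1 + x else 0)" for x :: int
  have "int (size S) = (\<Sum>x\<in>#S. 1 + x)"
    using assms(2) by (simp add: sum_mset.distrib)
  also have "\<dots> \<le> (\<Sum>x\<in>#S. w x)"
    by (rule sum_mset_mono) (auto simp: w_def)
  also have "\<dots> = (\<Sum>x\<in>{- int k..int k}. int (count S x) * w x)"
    using assms(1) by (intro sum_mset_image_eq_sum_count) (auto simp: bounded_seq_def)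
  also have "\<dots> = (\<Sum>x\<in>int ` {0..k}. int (count S x) * w x)"
  proof (rule sum.mono_neutral_right)
    show "\<forall>x\<in>{- int k..int k} - int ` {0..k}. int (count S x) * w x = 0"
    proof
      fix x assume x: "x \<in> {- int k..int k} - int ` {0..k}"
      have "x < 0"
      proof (rule ccontr)
        assume "\<not> x < 0"
        then have "x = int (nat x)" "nat x \<in> {0..k}"
          using x by auto
        then show False
          using x by blast
      qed
      then show "int (count S x) * w x = 0"
        by (simp add: w_def)
    qed
  qed auto
  also have "\<dots> = (\<Sum>i=0..k. int (count S (int i)) * w (int i))"
    by (simp add: sum.reindex)
  also have "\<dots> = int (count S 0) + (\<Sum>i=1..k. int (count S (int i)) * w (int i))"
    by (simp add: sum.atLeast_Suc_atMost w_def)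
  also have "(\<Sum>i=1..k. int (count S (int i)) * w (int i)) \<le> (\<Sum>i=1..k. int r * (int i + 1))"
    using few by (intro sum_mono) (auto simp: w_def intro!: mult_mono)
  also have "\<dots> = int (r * (\<Sum>i=1..k. i + 1))"
    by (simp add: sum_distrib_left algebra_simps)
  finally show False
    using large by linarith
qed

section \<open>Nonnegativity of the multiplicities\<close>

text \<open>If \<open>n\<close> terms with sum \<open>-\<sigma>\<close> are completed by \<open>\<alpha>\<close> copies of \<open>a\<close> and \<open>\<beta>\<close> copies of \<open>-b\<close> to a
  zero-sum sequence of length \<open>c\<close>, then \<open>(a + b) * \<beta> = a * c - (a * n + \<sigma>)\<close>; hence the conclusion
  says that \<open>\<beta> \<ge> 0\<close>.\<close>
lemma balancing_bound:
  fixes a b c k n \<sigma> :: int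
  assumes a: "1 \<le> a" "a \<le> k" and b: "1 \<le> b" "b \<le> k"
    and n: "0 \<le> n" "n \<le> a + b - 1"
    and \<sigma>: "\<sigma> \<le> k * n" "b = k \<Longrightarrow> \<sigma> \<le> (k - 1) * n" "b = k - 1 \<Longrightarrow> k * n - \<sigma> \<noteq> 1"
    and ndvd: "n > 0 \<Longrightarrow> \<not> (a + b) dvd (a * n + \<sigma>)" "n = 0 \<Longrightarrow> \<sigma> = 0"
    and c: "c \<ge> k\<^sup>2 - k" and cong: "(a + b) dvd (a * c - (a * n + \<sigma>))"
  shows "a * n + \<sigma> \<le> a * c"
proof (cases "n = 0")
  case True
  have "k * (k - 1) \<ge> 0"
    using a by (intro mult_nonneg_nonneg) auto
  then have "c \<ge> 0"
    using c by (simp add: power2_eq_square algebra_simps)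
  then show ?thesis
    using True ndvd(2) a by simp
next
  case False
  then have n0: "n > 0"
    using n by simp
  \<comment> \<open>A bound free of \<open>n\<close> and \<open>\<sigma>\<close>. For
    \<open>b = k\<close> the sharper estimate \<open>\<sigma> \<le> (k - 1) * n\<close> compensates
    for the larger range of \<open>n\<close>.\<close>
  have weak: "a * n + \<sigma> \<le> (a + k - 1)\<^sup>2 + b - k"
  proof (cases "b = k")
    case True
    have "a * n + \<sigma> \<le> (a + k - 1) * n"
      using \<sigma>(2)[OF True] by (simp add: algebra_simps)
    also have "\<dots> \<le> (a + k - 1) * (a + k - 1)"
      using n True a by (intro mult_left_mono) auto
    finally show ?thesis
      using True by (simp add: power2_eq_square)
  next
    case False
    have "a * n + \<sigma> \<le> (a + k) * n"
      using \<sigma>(1) by (simp add: algebra_simps)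
    also have "\<dots> \<le> (a + k) * (a + b - 1)"
      using n a b by (intro mult_left_mono) auto
    also have "\<dots> = (a + k) * (a + k - 2) - (a + k) * (k - 1 - b)"
      by (simp add: algebra_simps)
    also have "\<dots> \<le> (a + k) * (a + k - 2) - 1 * (k - 1 - b)"
      using False a b by (intro diff_left_mono mult_right_mono) auto
    finally show ?thesis
      by (simp add: power2_eq_square algebra_simps)
  qed
  show ?thesis
  proof (rule ccontr)
    assume neg: "\<not> ?thesis"
    \<comment> \<open>The excess of \<open>a * n + \<sigma>\<close> over \<open>a * c\<close> is a
      positive multiple of \<open>a + b\<close>, hence at least \<open>a + b\<close>.\<close>
    then have "a + b \<le> a * n + \<sigma> - a * c"
      using cong by (metis dvd_diff_commute diff_gt_0_iff_gt not_le zdvd_imp_le)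
    moreover have "a * c \<ge> a * (k\<^sup>2 - k)"
      using c a by (intro mult_left_mono) auto
    ultimately have big: "a * n + \<sigma> \<ge> a * (k\<^sup>2 - k) + a + b"
      by linarith
    \<comment> \<open>\<open>weak\<close> and \<open>big\<close> contradict each other except for
      \<open>a = k = 2\<close> and \<open>a = k = 3\<close>, where the few remaining values of
      \<open>n\<close> and \<open>\<sigma>\<close> are examined one by one.\<close>
    consider "k \<ge> 4 \<or> a = 1 \<or> (k = 3 \<and> a = 2)" | "k = 2" "a = 2" | "k = 3" "a = 3"
      using a b by linarith
    then show False
    proof cases
      case 1
      then have "a = 1 \<or> 2 * k + a - 1 \<le> k\<^sup>2 - k + 1"
      proof (elim disjE)
        assume "k \<ge> 4"
        then have "4 * k \<le> k * k"
          by (intro mult_right_mono) auto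
        then have "2 * k + a - 1 \<le> k\<^sup>2 - k + 1"
          unfolding power2_eq_square using a \<open>k \<ge> 4\<close> by linarith
        then show ?thesis ..
      qed auto
      then have "(a - 1) * (2 * k + a - 1) \<le> (a - 1) * (k\<^sup>2 - k + 1)"
        using a by (auto intro: mult_left_mono)
      moreover have "(a + k - 1)\<^sup>2 = k\<^sup>2 + (a - 1) * (2 * k + a - 1)"
        "a * (k\<^sup>2 - k) + a = (k\<^sup>2 - k + 1) + (a - 1) * (k\<^sup>2 - k + 1)"
        by (simp_all add: power2_eq_square algebra_simps)
      ultimately have "a * (k\<^sup>2 - k) + a + k > (a + k - 1)\<^sup>2"
        by linarith
      then show False
        using weak big by linarith
    next
      case 2
      have large: "2 * n + \<sigma> \<ge> 6 + b" "c \<ge> 2" "2 * n + \<sigma> > 2 * c"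
        using big c neg 2 by (auto simp: power2_eq_square)
      consider "b = 1" "n \<le> 2" | "b = 2" "n \<le> 3"
        using b n 2 by linarith
      then show False
      proof cases
        case 1
        \<comment> \<open>Size alone leaves \<open>\<sigma> = 3\<close> or
          \<open>\<sigma> = 4\<close>; the former has \<open>k * n - \<sigma> = 1\<close>, which is
          excluded for \<open>b = k - 1\<close>. The value \<open>\<sigma> = 11\<close> in the case
          \<open>a = k = 3\<close>, \<open>b = 2\<close> is excluded in the same way.\<close>
        then have "n = 2" "\<sigma> = 4"
          using \<sigma> large 2 by auto
        then show False
          using cong large 1 2 by simp presburger
      next
        case 2
        then have "n = 3" "\<sigma> \<le> 3" "\<sigma> \<ge> 2"
          using \<sigma> large \<open>k = 2\<close> by auto
        then show False
          using cong ndvd(1) 2 \<open>a = 2\<close> by simp presburger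
      qed
    next
      case 3
      have large: "3 * n + \<sigma> \<ge> 21 + b" "c \<ge> 6" "3 * n + \<sigma> > 3 * c"
        using big c neg 3 by (auto simp: power2_eq_square)
      consider "b = 1" "n \<le> 3" | "b = 2" "n \<le> 4" | "b = 3" "n \<le> 5"
        using b n 3 by linarith
      then show False
      proof cases
        case 1
        then show False
          using \<sigma>(1) large 3 by auto
      next
        case 2
        then have "n = 4" "\<sigma> = 12"
          using \<sigma> large 3 by auto
        then show False
          using cong large 2 3 by simp presburger
      next
        case 3
        then have "n = 5" "\<sigma> \<le> 10" "\<sigma> \<ge> 9"
          using \<sigma> large \<open>k = 3\<close> by auto
        then show False
          using cong ndvd(1) 3 \<open>a = 3\<close> by simp presburger
      qed
    qed
  qed
qed

section \<open>A lower bound for \<open>t\<close> from its divisors\<close>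

lemma dvd_of_Lcm_dvd:
  fixes k t d :: nat
  assumes "Lcm {2..max 2 (2 * k - 1)} dvd t" and "1 \<le> d" "d \<le> max 2 (2 * k - 1)"
  shows "d dvd t"
proof (cases "d = 1")
  case False
  then have "d dvd Lcm {2..max 2 (2 * k - 1)}"
    using assms by (intro dvd_Lcm) auto
  then show ?thesis
    using assms(1) by (rule dvd_trans)
qed simp

text \<open>The factors are pairwise coprime: neighbours always are, and the outer two are odd with
  difference 2.\<close>

lemma three_consecutive_dvd:
  fixes j t :: nat
  assumes "2 * j + 1 dvd t" "2 * j + 2 dvd t" "2 * j + 3 dvd t"
  shows "(2 * j + 1) * (2 * j + 2) * (2 * j + 3) dvd t"
proof -
  have "coprime (2 * j + 1) (2 * j + 2)" "coprime (2 * j + 2) (2 * j + 3)"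
    using coprime_Suc_right_nat[of "2 * j + 1"] coprime_Suc_right_nat[of "2 * j + 2"]
    by (simp_all add: numeral_3_eq_3 numeral_2_eq_2)
  moreover have "coprime (2 * j + 1) (2 * j + 3)"
  proof (rule coprimeI)
    fix d assume d: "d dvd 2 * j + 1" "d dvd 2 * j + 3"
    then have "d dvd (2 * j + 3) - (2 * j + 1)"
      by (rule dvd_diff_nat[rotated])
    then have "d dvd 2"
      by simp
    then have "d dvd 1"
      using d(1) by (metis dvd_add_right_iff dvd_mult2)
    then show "is_unit d" .
  qed
  ultimately have "coprime ((2 * j + 1) * (2 * j + 2)) (2 * j + 3)"
    by (simp only: coprime_mult_left_iff)
  moreover have "(2 * j + 1) * (2 * j + 2) dvd t"
    using assms(1,2) \<open>coprime (2 * j + 1) (2 * j + 2)\<close> by (rule divides_mult)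
  ultimately show ?thesis
    using assms(3) by (metis divides_mult)
qed

lemma sum_Suc_upto_doubled: "2 * (\<Sum>i=1..k. i + 1) = k * (k + 3)" for k :: nat
  by (induction k) (auto simp: algebra_simps)

text \<open>The numbers \<open>2k - 1\<close>, \<open>2k - 2\<close>, \<open>2k - 3\<close> are pairwise coprime, and their product has at most the
  factor 3 in common with \<open>2k - 5\<close>; so \<open>t\<close> is at least of order \<open>k\<^sup>4\<close>.\<close>
lemma lower_bound_of_Lcm_dvd:
  fixes k t :: nat
  assumes dvd: "Lcm {2..max 2 (2 * k - 1)} dvd t" and "k > 0" "t > 0"
  shows "(max 1 (k\<^sup>2 - 2) - 1) * (\<Sum>i=1..k. i + 1) < t"
proof (cases "k = 1")
  case False
  define j where "j = k - 2"
  have k: "k = j + 2"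
    using False \<open>k > 0\<close> by (simp add: j_def)
  have "2 * j + 1 dvd t" "2 * j + 2 dvd t" "2 * j + 3 dvd t"
    using k by (auto intro!: dvd_of_Lcm_dvd[OF dvd])
  note three = three_consecutive_dvd[OF this]
  have "max 1 (k\<^sup>2 - 2) - 1 = j * j + 4 * j + 1"
    by (simp add: k power2_eq_square algebra_simps)
  moreover have "(j * j + 4 * j + 1) * ((j + 2) * (j + 5)) < 2 * t"
  proof (cases "j \<le> 2")
    case True
    have "(2 * j + 1) * (2 * j + 2) * (2 * j + 3) \<le> t"
      using three \<open>t > 0\<close> by (rule dvd_imp_le)
    moreover have "j = 0 \<or> j = 1 \<or> j = 2"
      using True by linarith
    ultimately show ?thesis
      by (elim disjE) simp_all
  next
    case False
    \<comment> \<open>Three factors give only cubic growth against a quartic, so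
      \<open>2 * i + 5\<close>, which is \<open>2k - 5\<close>, joins them. After the shift by 3 the
      final polynomial inequality holds coefficient by coefficient.\<close>
    define i where "i = j - 3"
    have j: "j = i + 3"
      using False by (simp add: i_def)
    define d where "d = (2 * i + 7) * (2 * i + 8) * (2 * i + 9)"
    have d: "d dvd t"
      using three by (simp add: d_def j algebra_simps)
    have m: "2 * i + 5 dvd t"
      using k j by (intro dvd_of_Lcm_dvd[OF dvd]) auto
    have odd: "coprime (2 * i + 5) x" if "x = 2 * i + 7 \<or> x = 2 * i + 9" for x
    proof (rule coprimeI)
      fix e assume e: "e dvd 2 * i + 5" "e dvd x"
      then have "e dvd x - (2 * i + 5)"
        by (rule dvd_diff_nat[rotated])
      then have "e dvd 2 \<or> e dvd 4"
        using that by auto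
      then have "e dvd 2 ^ 2"
        using dvd_trans[of e 2 4] by auto
      moreover have "odd (2 * i + 5)"
        by simp
      then have "odd e"
        using e(1) dvd_trans by blast
      then have "coprime e (2 ^ 2)"
        by (metis coprime_power_right_iff coprime_right_2_iff_odd)
      ultimately show "is_unit e"
        by (simp only: coprime_absorb_left)
    qed
    have "gcd (2 * i + 5) d = gcd (2 * i + 5) (2 * i + 8)"
      using odd[of "2 * i + 7"] odd[of "2 * i + 9"] unfolding d_def
      by (simp only: gcd_mult_right_left_cancel gcd_mult_right_right_cancel simp_thms)
    also have "\<dots> dvd (2 * i + 8) - (2 * i + 5)"
      by (intro dvd_diff_nat) auto
    finally have "gcd (2 * i + 5) d \<le> 3"
      by (simp add: dvd_imp_le)
    moreover have "lcm (2 * i + 5) d \<le> t"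
      using d m \<open>t > 0\<close> by (intro dvd_imp_le) auto
    ultimately have "gcd (2 * i + 5) d * lcm (2 * i + 5) d \<le> 3 * t"
      by (rule mult_le_mono)
    then have "(2 * i + 5) * d \<le> 3 * t"
      by (simp only: prod_gcd_lcm_nat[symmetric])
    moreover have "3 * ((j * j + 4 * j + 1) * ((j + 2) * (j + 5))) < 2 * ((2 * i + 5) * d)"
      by (simp add: j d_def algebra_simps)
    ultimately show ?thesis
      by linarith
  qed
  moreover have "2 * (\<Sum>i=1..k. i + 1) = (j + 2) * (j + 5)"
    unfolding sum_Suc_upto_doubled by (simp add: k)
  ultimately have "2 * ((max 1 (k\<^sup>2 - 2) - 1) * (\<Sum>i=1..k. i + 1)) < 2 * t"
    by (metis mult.left_commute)
  then show ?thesis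
    by simp
qed (use assms in simp)

section \<open>Completing \<open>R\<close> to a zero-sum sequence of length \<open>c\<close>\<close>

text \<open>Here \<open>\<alpha>\<close> is the number of copies of \<open>a\<close> in the
  completion, and its hypothesis comes from \<open>a * \<alpha> = b * \<beta> - s \<le> k * (\<beta>
  + n) = k * (c - \<alpha>)\<close>. For \<open>k \<ge> 2\<close>, a value
  \<open>\<alpha> \<ge> k\<^sup>2 - 1\<close> would give
  \<open>a * (k\<^sup>2 - 1 - k) \<le> 0\<close>.\<close>

lemma frequency_bound:
  fixes a b c k \<alpha> :: int
  assumes a: "1 \<le> a" "a \<le> k" and b: "1 \<le> b" "b \<le> k"
    and c: "c < k\<^sup>2 - k + a + b" and \<alpha>: "(k + a) * \<alpha> \<le> k * c"
  shows "\<alpha> \<le> max 1 (k\<^sup>2 - 2)"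
proof (rule ccontr)
  assume "\<not> ?thesis"
  then have big: "\<alpha> \<ge> 2" "\<alpha> \<ge> k\<^sup>2 - 1"
    by auto
  show False
  proof (cases "k = 1")
    case True
    then show False
      using assms big by auto
  next
    case False
    then have "2 * k \<le> k * k"
      using a by (intro mult_right_mono) auto
    then have "a * (k\<^sup>2 - 1 - k) > 0"
      unfolding power2_eq_square using a False by (intro mult_pos_pos) linarith+
    moreover have "(k + a) * (k\<^sup>2 - 1) \<le> (k + a) * \<alpha>"
      using big a by (intro mult_left_mono) auto
    moreover have "k * c \<le> k * (k\<^sup>2 - k + a + k - 1)"
      using c b by (intro mult_left_mono) auto
    ultimately show False
      using \<alpha> by (simp add: power2_eq_square algebra_simps)
  qed
qed

lemma sum_mset_neq_1:
  fixes M :: "int multiset"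
  assumes "\<And>y. y \<in># M \<Longrightarrow> 0 \<le> y \<and> y \<noteq> 1"
  shows "sum_mset M \<noteq> 1"
proof -
  have "0 \<le> sum_mset M \<and> sum_mset M \<noteq> 1"
    using assms
  proof (induction M)
    case (add y M)
    then have "0 \<le> sum_mset M \<and> sum_mset M \<noteq> 1" "0 \<le> y \<and> y \<noteq> 1"
      by auto
    then show ?case
      by auto
  qed simp
  then show ?thesis ..
qed

lemma sum_mset_lower_bound:
  fixes M :: "int multiset"
  assumes "\<And>x. x \<in># M \<Longrightarrow> - l \<le> x"
  shows "- (l * int (size M)) \<le> sum_mset M"
  using assms
proof (induction M)
  case (add x M)
  then have "- (l * int (size M)) \<le> sum_mset M" "- l \<le> x"
    by auto
  then show ?case
    by (simp add: algebra_simps)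
qed simp

lemma sum_mset_upper_bound:
  fixes M :: "int multiset"
  assumes "\<And>x. x \<in># M \<Longrightarrow> x \<le> l"
  shows "sum_mset M \<le> l * int (size M)"
  using assms
proof (induction M)
  case (add x M)
  then have "sum_mset M \<le> l * int (size M)" "x \<le> l"
    by auto
  then show ?case
    by (simp add: algebra_simps)
qed simp

text \<open>The numbers \<open>k + x\<close> are nonnegative and none of them is 1, so they cannot
  add up to 1. This serves \<open>balancing_bound\<close> when \<open>b = k - 1\<close>, as
  \<open>R\<close> avoids \<open>- b\<close>.\<close>

lemma sum_mset_shift_neq_1:
  fixes M :: "int multiset"
  assumes "\<And>x. x \<in># M \<Longrightarrow> - k \<le> x" "1 - k \<notin># M"
  shows "k * int (size M) + sum_mset M \<noteq> 1"
proof -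
  have "sum_mset (image_mset (\<lambda>x. k + x) M) \<noteq> 1"
  proof (rule sum_mset_neq_1)
    fix y assume "y \<in># image_mset (\<lambda>x. k + x) M"
    then obtain x where "x \<in># M" "y = k + x"
      by auto
    moreover from this have "x \<noteq> 1 - k"
      using assms(2) by blast
    ultimately show "0 \<le> y \<and> y \<noteq> 1"
      using assms(1)[of x] by linarith
  qed
  then show ?thesis
    by (simp add: sum_mset.distrib algebra_simps)
qed

lemma sum_mset_uminus: "sum_mset (image_mset uminus M) = - sum_mset M" for M :: "int multiset"
  by (induction M) auto

lemma zero_sum_submultiset_of_size:
  fixes a b c k t :: nat
  assumes S: "bounded_seq k S" "sum_mset S = 0" "size S = t + c"
    and a: "1 \<le> a" "a \<le> k" and b: "1 \<le> b" "b \<le> k" and dvd: "(a + b) dvd a * t"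
    and c: "k\<^sup>2 - k \<le> c" "c < k\<^sup>2 - k + a + b"
    and count_a: "max 1 (k\<^sup>2 - 2) \<le> count S (int a)"
    and count_b: "max 1 (k\<^sup>2 - 2) \<le> count S (- int b)"
  obtains T where "T \<subseteq># S" "sum_mset T = 0" "size T = c"
proof -
  define Q where "Q = filter_mset (\<lambda>x. x \<noteq> int a \<and> x \<noteq> - int b) S"
  define u v where "u = count S (int a)" and "v = count S (- int b)"
  have split: "S = Q + (replicate_mset u (int a) + replicate_mset v (- int b))"
    using a b by (intro multiset_eqI) (auto simp: Q_def u_def v_def)
  \<comment> \<open>Modulo \<open>a + b\<close> the weight \<open>x - a\<close> vanishes at
    \<open>a\<close> and at \<open>- b\<close>, so \<open>Q\<close> carries the weight of all of
    \<open>S\<close>, which is \<open>- a * (t + c)\<close> and thus congruent to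
    \<open>- a * c\<close>.\<close>
  obtain R where R: "R \<subseteq># Q" "size R < a + b"
    "int (a + b) dvd (\<Sum>x\<in>#Q. x - int a) - (\<Sum>x\<in>#R. x - int a)"
    "R = {#} \<or> \<not> int (a + b) dvd (\<Sum>x\<in>#R. x - int a)"
    using short_congruent_submultiset[of "a + b" Q "\<lambda>x. x - int a"] a by auto
  define n s where "n = int (size R)" and "s = sum_mset R"
  have sumR: "(\<Sum>x\<in>#M. x - int a) = sum_mset M - int a * int (size M)" for M
    by (induction M) (auto simp: algebra_simps)
  have R_elem: "- int k \<le> x" "x \<le> int k" "x \<noteq> int a" "x \<noteq> - int b" if "x \<in># R" for x
    using that mset_subset_eqD[OF R(1)] S(1) by (auto simp: Q_def bounded_seq_def)
  have "0 = sum_mset Q + int a * int u - int b * int v"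
    using S(2) by (subst (asm) split) (simp add: algebra_simps)
  moreover have "int t + int c = int (size Q) + int u + int v"
    using S(3) by (subst (asm) split) simp
  then have "int a * (int t + int c) = int a * (int (size Q) + int u + int v)"
    by (rule arg_cong)
  ultimately have sumQ: "(\<Sum>x\<in>#Q. x - int a) = int (a + b) * int v - int a * int t - int a * int c"
    unfolding sumR by (simp add: algebra_simps)
  have cong: "int (a + b) dvd int a * int c - (int a * n - s)"
  proof -
    have "int (a + b) dvd int a * int t"
      using dvd by (metis of_nat_dvd_iff of_nat_mult)
    moreover have "int (a + b) dvd int (a + b) * int v - int a * int t - int a * int c - (s - int a * n)"
      using R(3) unfolding sumQ unfolding sumR s_def n_def .
    ultimately have "int (a + b) dvd int (a + b) * int v - int a * int t
        - (int (a + b) * int v - int a * int t - int a * int c - (s - int a * n))"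
      by (rule dvd_diff[OF dvd_diff[OF dvd_triv_left]])
    then show ?thesis
      by (simp add: algebra_simps)
  qed
  have "int (k\<^sup>2 - k) = (int k)\<^sup>2 - int k"
    by (simp add: of_nat_diff power2_eq_square)
  then have c_int: "(int k)\<^sup>2 - int k \<le> int c" "int c < (int k)\<^sup>2 - int k + int a + int b"
    using c by linarith+
  have n: "0 \<le> n" "n \<le> int a + int b - 1"
    using R(2) by (auto simp: n_def)
  have s0: "s = 0" if "n = 0"
    using that by (auto simp: n_def s_def)
  \<comment> \<open>The two expressions will be \<open>(a + b) * \<beta>\<close> and
    \<open>(a + b) * \<alpha>\<close>. The sign of \<open>s\<close> endangers only one of them; its
    nonnegativity forces \<open>n \<le> c\<close>, which settles the other.\<close>
  have nonneg: "int a * (int c - n) + s \<ge> 0 \<and> int b * (int c - n) - s \<ge> 0"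
  proof (cases "s \<le> 0")
    case True
    have "int a * n + (- s) \<le> int a * int c"
    proof (rule balancing_bound[of "int a" "int k" "int b"])
      show "- s \<le> int k * n"
        using sum_mset_lower_bound[of R "int k"] R_elem by (auto simp: s_def n_def)
      show "- s \<le> (int k - 1) * n" if "int b = int k"
        using sum_mset_lower_bound[of R "int k - 1"] R_elem that by (force simp: s_def n_def)
      show "int k * n - (- s) \<noteq> 1" if "int b = int k - 1"
        using sum_mset_shift_neq_1[of R "int k"] R_elem that by (force simp: s_def n_def)
      show "\<not> int a + int b dvd int a * n + - s" if "n > 0"
        using R(4) that unfolding sumR s_def n_def
        by (auto simp: algebra_simps dvd_diff_commute)
      show "int a + int b dvd int a * int c - (int a * n + - s)"
        using cong by simp
    qed (use a b n s0 c_int in auto)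
    then have *: "int a * (int c - n) + s \<ge> 0"
      by (simp add: algebra_simps)
    then have "int a * (int c - n) \<ge> 0"
      using True by linarith
    then have "int c - n \<ge> 0"
      using a by (simp add: zero_le_mult_iff)
    then have "int b * (int c - n) \<ge> 0"
      by simp
    then show ?thesis
      using * True by linarith
  next
    case False
    have swap: "int b * x + s = int (a + b) * x - (int a * x - s)" for x
      by (simp add: algebra_simps)
    \<comment> \<open>The mirror image: negating all terms exchanges \<open>a\<close> and
      \<open>b\<close> and turns \<open>- s\<close> into \<open>s\<close>.\<close>
    have "int b * n + s \<le> int b * int c"
    proof (rule balancing_bound[of "int b" "int k" "int a"])
      show "s \<le> int k * n"
        using sum_mset_upper_bound[of R "int k"] R_elem by (auto simp: s_def n_def)
      show "s \<le> (int k - 1) * n" if "int a = int k"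
        using sum_mset_upper_bound[of R "int k - 1"] R_elem that by (force simp: s_def n_def)
      show "int k * n - s \<noteq> 1" if "int a = int k - 1"
        using sum_mset_shift_neq_1[of "image_mset uminus R" "int k"] R_elem that
        by (force simp: s_def n_def sum_mset_uminus)
      show "\<not> int b + int a dvd int b * n + s" if "n > 0"
      proof
        assume "int b + int a dvd int b * n + s"
        then have "int (a + b) dvd int (a + b) * n - (int b * n + s)"
          by (intro dvd_diff[OF dvd_triv_left]) (simp add: add.commute)
        then have "int (a + b) dvd int a * n - s"
          by (simp add: algebra_simps)
        then show False
          using R(4) that unfolding sumR s_def n_def
          by (auto simp: dvd_diff_commute)
      qed
      have "int (a + b) dvd int (a + b) * (int c - n) - (int a * int c - (int a * n - s))"
        using cong by (rule dvd_diff[OF dvd_triv_left])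
      then show "int b + int a dvd int b * int c - (int b * n + s)"
        by (simp add: algebra_simps)
    qed (use a b n s0 c_int in auto)
    then have *: "int b * (int c - n) - s \<ge> 0"
      by (simp add: algebra_simps)
    then have "int b * (int c - n) \<ge> 0"
      using False by linarith
    then have "int c - n \<ge> 0"
      using b by (simp add: zero_le_mult_iff)
    then have "int a * (int c - n) \<ge> 0"
      by simp
    then show ?thesis
      using * False by linarith
  qed
  have "int (a + b) dvd int a * (int c - n) + s"
    using cong by (simp add: algebra_simps)
  then obtain \<beta> where \<beta>: "int a * (int c - n) + s = int (a + b) * \<beta>"
    by (rule dvdE)
  define \<alpha> where "\<alpha> = int c - n - \<beta>"
  have \<alpha>: "int b * (int c - n) - s = int (a + b) * \<alpha>"
    using \<beta> by (simp add: \<alpha>_def algebra_simps)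
  have balance: "s + int a * \<alpha> = int b * \<beta>"
    using \<beta> by (simp add: \<alpha>_def algebra_simps)
  have "\<alpha> \<ge> 0" "\<beta> \<ge> 0"
    using nonneg a unfolding \<alpha> \<beta> by (auto simp: zero_le_mult_iff)
  have s_bounds: "- (int k * n) \<le> s" "s \<le> int k * n"
    using sum_mset_lower_bound[of R "int k"] sum_mset_upper_bound[of R "int k"] R_elem
    by (auto simp: s_def n_def)
  have "\<alpha> \<le> max 1 ((int k)\<^sup>2 - 2)"
  proof (rule frequency_bound[of "int a" _ "int b" "int c"])
    have "int b * \<beta> \<le> int k * \<beta>"
      using b \<open>\<beta> \<ge> 0\<close> by (intro mult_right_mono) auto
    then show "(int k + int a) * \<alpha> \<le> int k * int c"
      using balance s_bounds by (simp add: \<alpha>_def algebra_simps)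
  qed (use a b c_int in auto)
  moreover have "\<beta> \<le> max 1 ((int k)\<^sup>2 - 2)"
  proof (rule frequency_bound[of "int b" _ "int a" "int c"])
    have "int a * \<alpha> \<le> int k * \<alpha>"
      using a \<open>\<alpha> \<ge> 0\<close> by (intro mult_right_mono) auto
    then show "(int k + int b) * \<beta> \<le> int k * int c"
      using balance s_bounds by (simp add: \<alpha>_def algebra_simps)
  qed (use a b c_int in auto)
  moreover have "max 1 ((int k)\<^sup>2 - 2) \<le> int (max 1 (k\<^sup>2 - 2))"
    unfolding of_nat_power[symmetric] by linarith
  ultimately have le: "nat \<alpha> \<le> u" "nat \<beta> \<le> v"
    using count_a count_b unfolding u_def v_def by linarith+
  define T where "T = R + (replicate_mset (nat \<alpha>) (int a) + replicate_mset (nat \<beta>) (- int b))"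
  show ?thesis
  proof (rule that)
    show "T \<subseteq># S"
      unfolding T_def
      by (subst split, intro subset_mset.add_mono R(1))
        (use le in \<open>simp_all add: subseteq_mset_def\<close>)
    show "sum_mset T = 0"
      using balance \<open>\<alpha> \<ge> 0\<close> \<open>\<beta> \<ge> 0\<close> by (simp add: T_def s_def algebra_simps)
    have "int (size T) = int c"
      using \<open>\<alpha> \<ge> 0\<close> \<open>\<beta> \<ge> 0\<close> by (simp add: T_def \<alpha>_def n_def)
    then show "size T = c"
      by simp
  qed
qed

section \<open>The upper bound, by induction on the length\<close>

lemma count_image_mset_uminus: "count (image_mset uminus M) x = count M (- x)" for x :: int
  by (induction M) auto

lemma bounded_seq_uminus: "bounded_seq k S \<Longrightarrow> bounded_seq k (image_mset uminus S)"
  by (simp add: bounded_seq_def minus_le_iff)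

lemma submultiset_of_size_complement:
  fixes S :: "int multiset"
  assumes "C \<subseteq># S" "sum_mset C = 0" "sum_mset S = 0" "size S = t + size C"
  shows "\<exists>T. T \<subseteq># S \<and> sum_mset T = 0 \<and> size T = t"
  using assms by (intro exI[of _ "S - C"]) (auto simp: sum_mset_diff size_Diff_submset)

lemma good_length_of_Lcm_dvd:
  fixes k t :: nat
  assumes "k > 0" "t > 0" and Lcm: "Lcm {2..max 2 (2 * k - 1)} dvd t"
  shows "good_length k t (t + (k\<^sup>2 - k))"
proof -
  have "\<exists>T. T \<subseteq># S \<and> sum_mset T = 0 \<and> size T = t"
    if "bounded_seq k S" "sum_mset S = 0" "t + (k\<^sup>2 - k) \<le> size S" for S
    using that
  proof (induction "size S" arbitrary: S rule: less_induct)
    case less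
    let ?goal = "\<exists>T. T \<subseteq># S \<and> sum_mset T = 0 \<and> size T = t"
    define c where "c = size S - t"
    have size_S: "size S = t + c"
      using less.prems by (simp add: c_def)
    have c: "k\<^sup>2 - k \<le> c"
      using less.prems by (simp add: c_def)
    have reduce: ?goal if "B \<subseteq># S" "sum_mset B = 0" "B \<noteq> {#}" "k\<^sup>2 - k + size B \<le> c" for B
    proof -
      have size: "size (S - B) = size S - size B"
        using that by (simp add: size_Diff_submset)
      have "size B > 0"
        using that by (simp add: nonempty_has_size)
      then have "size (S - B) < size S" "t + (k\<^sup>2 - k) \<le> size (S - B)"
        using that(4) size size_S by auto
      moreover have "bounded_seq k (S - B)"
        using less.prems(1) by (auto simp: bounded_seq_def dest: in_diffD)
      moreover have "sum_mset (S - B) = 0"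
        using that less.prems by (simp add: sum_mset_diff)
      ultimately obtain T where "T \<subseteq># S - B" "sum_mset T = 0" "size T = t"
        using less.hyps by blast
      moreover from this(1) have "T \<subseteq># S"
        by (rule subset_mset.order_trans) auto
      ultimately show ?goal
        by blast
    qed
    have complement: ?goal if "C \<subseteq># S" "sum_mset C = 0" "size C = c" for C
      using that less.prems(2) size_S by (intro submultiset_of_size_complement) auto
    show ?goal
    \<comment> \<open>Either more than \<open>c\<close> zeros are present, and \<open>c\<close> of
      them suffice, or at least \<open>t\<close> terms are nonzero, enough for the frequency
      count.\<close>
    proof (cases "count S 0 + t \<le> size S")
      case False
      then have "replicate_mset c 0 \<subseteq># S"
        using size_S by (simp flip: count_le_replicate_mset_subset_eq)
      then show ?goal
        by (rule complement) auto
    next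
      case zeros: True
      let ?A = "max 1 (k\<^sup>2 - 2)"
      have large: "count S 0 + (?A - 1) * (\<Sum>i=1..k. i + 1) < size S"
        using lower_bound_of_Lcm_dvd[OF Lcm assms(1,2)] zeros by linarith
      obtain a where a: "1 \<le> a" "a \<le> k" "?A - 1 < count S (int a)"
        using frequent_positive[OF less.prems(1,2) large] .
      obtain b where b: "1 \<le> b" "b \<le> k" "?A - 1 < count S (- int b)"
        using frequent_positive[of k "image_mset uminus S" "?A - 1"] large less.prems
        by (auto simp: sum_mset_uminus count_image_mset_uminus bounded_seq_uminus)
      \<comment> \<open>This makes the block of \<open>b\<close> terms \<open>a\<close> and
        \<open>a\<close> terms \<open>- b\<close> available in \<open>S\<close>.\<close>
      have "k \<le> ?A"
      proof (cases "k \<le> 2")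
        case True
        then have "k = 1 \<or> k = 2"
          using assms(1) by linarith
        then show ?thesis
          by auto
      next
        case False
        then have "3 * k \<le> k * k"
          by (intro mult_right_mono) auto
        then show ?thesis
          using False unfolding power2_eq_square by linarith
      qed
      then have few: "b \<le> count S (int a)" "a \<le> count S (- int b)"
        using a b by linarith+
      show ?goal
      proof (cases "k\<^sup>2 - k + a + b \<le> c")
        case True
        show ?goal
        proof (rule reduce)
          show "replicate_mset b (int a) + replicate_mset a (- int b) \<subseteq># S"
            using few a b by (auto simp: subseteq_mset_def)
        qed (use True a in auto)
      next
        case False
        \<comment> \<open>For \<open>a = b\<close> the sum may be \<open>2k\<close>, outside the
          range of the lcm, but \<open>2 dvd t\<close> already gives \<open>2 * a dvd a * t\<close>.
          Distinct \<open>a\<close>, \<open>b\<close> have sum at most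
          \<open>2k - 1\<close>.\<close>
        have dvd: "(a + b) dvd a * t"
        proof (cases "a = b")
          case True
          have "2 dvd t"
            by (rule dvd_of_Lcm_dvd[OF Lcm]) auto
          then show ?thesis
            using True by (simp add: mult_dvd_mono flip: mult_2_right)
        next
          case False
          then have "a + b dvd t"
            using a b by (intro dvd_of_Lcm_dvd[OF Lcm]) auto
          then show ?thesis
            by simp
        qed
        have "?A \<le> count S (int a)" "?A \<le> count S (- int b)" "c < k\<^sup>2 - k + a + b"
          using a b False by linarith+
        then obtain C where "C \<subseteq># S" "sum_mset C = 0" "size C = c"
          using zero_sum_submultiset_of_size[OF less.prems(1,2) size_S a(1,2) b(1,2) dvd c] by blast
        then show ?goal
          by (rule complement)
      qed
    qed
  qed
  then show ?thesis
    by (auto simp: good_length_def)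
qed

section \<open>The infinite case\<close>

lemma good_length_mono: "good_length k t l \<Longrightarrow> l \<le> l' \<Longrightarrow> good_length k t l'"
  unfolding good_length_def by (meson order_trans)

text \<open>The witness repeats the block of \<open>b\<close> terms \<open>a\<close> and
  \<open>a\<close> terms \<open>- b\<close>, so it is as long as desired. A zero-sum part with
  multiplicities \<open>x\<close>, \<open>y\<close> satisfies \<open>x * a = y * b\<close>;
  coprimality gives \<open>x = b * z\<close>, \<open>y = a * z\<close>, so its length is
  \<open>(a + b) * z\<close>.\<close>

lemma not_good_length_of_coprime:
  fixes a b k l t :: nat
  assumes "coprime a b" "1 \<le> a" "a \<le> k" "1 \<le> b" "b \<le> k" and ndvd: "\<not> (a + b) dvd t"
  shows "\<not> good_length k t l"
proof
  assume good: "good_length k t l"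
  define S where "S = replicate_mset (b * l) (int a) + replicate_mset (a * l) (- int b)"
  have "bounded_seq k S" "sum_mset S = 0"
    using assms by (auto simp: S_def bounded_seq_def)
  moreover have "l \<le> (a + b) * l"
    using assms(2) by (metis le_add1 mult_le_mono1 nat_mult_1 order_trans)
  then have "l \<le> size S"
    by (simp add: S_def algebra_simps)
  ultimately obtain T where T: "T \<subseteq># S" "sum_mset T = 0" "size T = t"
    using good unfolding good_length_def by blast
  define x y where "x = count T (int a)" and "y = count T (- int b)"
  have "set_mset T \<subseteq> {int a, - int b}"
    using set_mset_mono[OF T(1)] by (auto simp: S_def split: if_splits)
  then have "T = replicate_mset x (int a) + replicate_mset y (- int b)"
    using assms(2,4) by (intro multiset_eqI) (auto simp: x_def y_def not_in_iff[symmetric])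
  then have sz: "t = x + y" and "int x * int a - int y * int b = 0"
    using T(2,3) by auto
  then have eq: "x * a = y * b"
    by (metis eq_iff_diff_eq_0 of_nat_eq_iff of_nat_mult)
  then have "b dvd x * a"
    by simp
  then have "b dvd x"
    using assms(1) by (simp add: coprime_commute coprime_dvd_mult_left_iff)
  then obtain z where "x = b * z" ..
  moreover from this eq have "y = a * z"
    using assms(4) by auto
  ultimately have "t = (a + b) * z"
    using sz by (simp add: algebra_simps)
  then show False
    using ndvd by simp
qed

text \<open>Split the least non-divisor \<open>j\<close> of \<open>t\<close>:
  \<open>2 = 1 + 1\<close>, \<open>2 * m + 1 = m + (m + 1)\<close>, and
  \<open>2 * m = (m - 1) + (m + 1)\<close> for \<open>m \<ge> 2\<close>. In the last case
  \<open>m\<close> is even, since for odd \<open>m\<close> the smaller divisors 2 and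
  \<open>m\<close> of \<open>t\<close> would give \<open>2 * m dvd t\<close>; hence the summands are
  odd and coprime.\<close>

lemma coprime_sum_not_dvd:
  fixes k t :: nat
  assumes "k > 0" and ndvd: "\<not> Lcm {2..max 2 (2 * k - 1)} dvd t"
  obtains a b where "coprime a b" "1 \<le> a" "a \<le> k" "1 \<le> b" "b \<le> k" "\<not> (a + b) dvd t"
proof -
  let ?P = "\<lambda>j. 2 \<le> j \<and> j \<le> max 2 (2 * k - 1) \<and> \<not> j dvd t"
  have "\<exists>j. ?P j"
    using ndvd by (metis Lcm_least atLeastAtMost_iff)
  then obtain j where j: "?P j" and least: "\<And>i. i < j \<Longrightarrow> \<not> ?P i"
    using exists_least_iff[of ?P] by blast
  consider "j = 2" | m where "m \<ge> 1" "j = 2 * m + 1" | m where "m \<ge> 2" "j = 2 * m"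
  proof (cases "even j")
    case True
    then obtain m where "j = 2 * m" ..
    then show ?thesis
      using that(1) that(3)[of m] j by (cases "m = 1") auto
  next
    case False
    then obtain m where "j = 2 * m + 1" ..
    then show ?thesis
      using that(2)[of m] j by (cases "m = 0") auto
  qed
  then show ?thesis
  proof cases
    case 1
    then show ?thesis
      using that[of 1 1] 1 j assms(1) by (simp flip: numeral_2_eq_2)
  next
    case 2
    then have "m + 1 \<le> k"
      using j by auto
    then show ?thesis
      using that[of m "m + 1"] 2 j by (simp add: mult_2)
  next
    case 3
    then have m: "m + 1 \<le> k"
      using j by auto
    have "even m"
    proof (rule ccontr)
      assume "odd m"
      moreover have "2 dvd t" "m dvd t"
        using least[of 2] least[of m] 3 j by auto
      ultimately have "2 * m dvd t"
        by (intro divides_mult) auto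
      then show False
        using 3 j by simp
    qed
    have "coprime (m - 1) (m + 1)"
    proof (rule coprimeI)
      fix d assume d: "d dvd m - 1" "d dvd m + 1"
      then have "d dvd (m + 1) - (m - 1)"
        by (rule dvd_diff_nat[rotated])
      then have "d dvd 2"
        using 3 by simp
      moreover have "odd (m + 1)"
        using \<open>even m\<close> by simp
      then have "odd d"
        using d(2) dvd_trans by blast
      ultimately show "is_unit d"
        by (metis coprime_absorb_left coprime_right_2_iff_odd)
    qed
    then show ?thesis
      using that[of "m - 1" "m + 1"] 3 m j by (simp add: mult_2)
  qed
qed

section \<open>The lower bound in the finite case\<close>

text \<open>The zero-sum subsequences of the witness have lengths in the numerical semigroup generated by
  \<open>k\<close> and \<open>k + 1\<close>, whose Frobenius number is \<open>k\<^sup>2 - k - 1\<close>.\<close>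
lemma good_length_lower_bound:
  fixes k t l :: nat
  assumes "k > 0" "t > 0" "k dvd t" and good: "good_length k t l"
  shows "t + (k\<^sup>2 - k) \<le> l"
proof (rule ccontr)
  assume "\<not> ?thesis"
  then have "l \<le> t + (k\<^sup>2 - k) - 1"
    by simp
  then have good: "good_length k t (t + (k\<^sup>2 - k) - 1)"
    using good good_length_mono by blast
  show False
  proof (cases "k = 1")
    case True
    have "\<exists>T. T \<subseteq># replicate_mset (t - 1) 0 \<and> sum_mset T = (0::int) \<and> size T = t"
      using good True unfolding good_length_def
      by (elim allE[of _ "replicate_mset (t - 1) 0"]) (auto simp: bounded_seq_def)
    then show False
      using size_mset_mono \<open>t > 0\<close> by fastforce
  next
    case False
    then have k: "k \<ge> 2"
      using assms(1) by simp
    obtain q where q: "t = k * q"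
      using assms(3) ..
    then have "q \<ge> 1"
      using assms(2) by (cases q) auto
    obtain k' q' where k': "k = k' + 1" and q': "q = q' + 1"
      using assms(1) \<open>q \<ge> 1\<close> by (metis Suc_eq_plus1 Suc_le_D gr0_conv_Suc One_nat_def)
    \<comment> \<open>With \<open>t = k * q\<close>: \<open>k - 1\<close> terms \<open>k\<close> and
      \<open>q - 1\<close> terms \<open>k - 1\<close>, each balanced by terms \<open>- 1\<close>
      into blocks of lengths \<open>k + 1\<close> and \<open>k\<close>. The total is
      \<open>(k - 1) * (k + 1) + (q - 1) * k\<close>, one short of the claimed bound.\<close>
    define S where "S = replicate_mset k' (int k) + replicate_mset q' (int k')
      + replicate_mset (k' * k + q' * k') (- 1)"
    have "bounded_seq k S"
      using k by (auto simp: S_def bounded_seq_def k')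
    moreover have "sum_mset S = 0"
      by (simp add: S_def algebra_simps)
    moreover have "size S = t + (k\<^sup>2 - k) - 1"
      by (simp add: S_def q k' q' power2_eq_square algebra_simps)
    ultimately obtain T where T: "T \<subseteq># S" "sum_mset T = 0" "size T = t"
      using good unfolding good_length_def by (metis order_refl)
    define x y z where "x = count T (int k)" and "y = count T (int k')" and "z = count T (- 1)"
    have "set_mset T \<subseteq> {int k, int k', - 1}"
      using set_mset_mono[OF T(1)] by (auto simp: S_def split: if_splits)
    then have "T = replicate_mset x (int k) + replicate_mset y (int k') + replicate_mset z (- 1)"
      by (intro multiset_eqI) (auto simp: x_def y_def z_def k' not_in_iff[symmetric])
    then have sz: "t = x + y + z" and sum: "int x * int k + int y * int k' = int z"
      using T(2,3) by auto
    have "int t = int (x * (k + 1) + y * k)"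
      unfolding sz k' using sum by (simp add: k' algebra_simps)
    then have eq: "k * q = x * (k + 1) + y * k"
      unfolding q by (simp only: of_nat_eq_iff)
    have "x \<le> k'" "y \<le> q'"
      using mset_subset_eq_count[OF T(1), of "int k"] mset_subset_eq_count[OF T(1), of "int k'"]
      by (auto simp: S_def x_def y_def k')
    \<comment> \<open>Reading the length equation modulo \<open>k\<close> gives
      \<open>k dvd x\<close>, so \<open>x \<le> k - 1\<close> forces \<open>x = 0\<close>; then
      \<open>y = q\<close> exceeds the \<open>q - 1\<close> available copies.\<close>
    have "x + (x + y) * k = k * q"
      using eq by (simp add: algebra_simps)
    then have "k dvd x + (x + y) * k"
      by simp
    then have "k dvd x"
      by (simp only: dvd_add_times_triv_right_iff)
    then have "x = 0"
      using \<open>x \<le> k'\<close> k' by (auto dest: dvd_imp_le)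
    then have "y = q"
      using eq k by auto
    then show False
      using \<open>y \<le> q'\<close> q' by simp
  qed
qed

theorem theorem1p2:
  fixes k t :: nat
  assumes "k > 0" and "t > 0"
  shows "s_prime t k =
    (if Lcm {2..max 2 (2 * k - 1)} dvd t then enat (t + k^2 - k) else \<infinity>)"
proof (cases "Lcm {2..max 2 (2 * k - 1)} dvd t")
  case True
  have "k dvd t"
    using assms(1) by (intro dvd_of_Lcm_dvd[OF True]) auto
  have good: "good_length k t (t + (k\<^sup>2 - k))"
    using good_length_of_Lcm_dvd[OF assms True] .
  then have "(LEAST l. good_length k t l) = t + (k\<^sup>2 - k)"
    using good_length_lower_bound[OF assms \<open>k dvd t\<close>] by (rule Least_equality)
  \<comment> \<open>Subtraction on naturals is truncated; the bracketings agree because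
    \<open>k \<le> k\<^sup>2\<close>.\<close>
  moreover have "t + k^2 - k = t + (k\<^sup>2 - k)"
    by (simp add: power2_eq_square)
  ultimately show ?thesis
    using True good by (auto simp: s_prime_def)
next
  case False
  then obtain a b where "coprime a b" "1 \<le> a" "a \<le> k" "1 \<le> b" "b \<le> k" "\<not> (a + b) dvd t"
    using coprime_sum_not_dvd assms(1) by blast
  then have "\<not> good_length k t l" for l
    by (rule not_good_length_of_coprime)
  then show ?thesis
    using False by (simp add: s_prime_def)
qed

end
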